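(* Let $1\leq p\leq\infty$ and let $T=M_wEM_u : L^p(\Sigma)\to L^p(\Sigma)$, $f\mapsto wE(uf)$, be a bounded operator. Then the following are equivalent: (a) $M_wEM_u$ is quasinilpotent; (b) $E(uw)=0$ a.e.; (c) $M_{wE(uw)}EM_u=0$, i.e. the operator $f\mapsto wE(uw)E(uf)$ is zero on $L^p(\Sigma)$.
   Context: $(X,\Sigma,\mu)$ is a complete $\sigma$-finite measure space and $\mathcal{A}\subseteq\Sigma$ is a sub-$\sigma$-algebra such that $(X,\mathcal{A},\mu|_{\mathcal{A}})$ is $\sigma$-finite. $L^p(\Sigma)=L^p(X,\Sigma,\mu)$ is the complex $L^p$ space; $L^0(\Sigma)$ (resp. $L^0(\mathcal{A})$) is the space of equivalence classes of a.e. finite-valued $\Sigma$-measurable (resp. $\mathcal{A}$-measurable) functions. $E=E^{\mathcal{A}}$ is the conditional expectation operator: for nonnegative measurable $f$, $E(f)$ is the unique $\mathcal{A}$-measurable function with $\int_A f\,d\mu=\int_A E(f)\,d\mu$ for all $A\in\mathcal{A}$, extended linearly to $\mathcal{D}(E)=\{g\in L^0(\Sigma) : E(|g|)\in L^0(\mathcal{A})\}$. The functions $u,w$ are given elements of $\mathcal{D}(E)$, and $M_g$ denotes multiplication by a function $g$. An operator $T$ is quasinilpotent if $\sigma(T)=\{0\}$, where $\sigma(T)=\{\lambda\in\mathbb{C} : T-\lambda I\text{ is not invertible}\}$. *)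

theory Defs
  imports "HOL-Probability.Probability"
begin

section \<open>Complex Lebesgue spaces\<close>

text \<open>
  Elements of \<open>L\<^sup>p\<close> are handled through representatives: \<open>Lp_space M p\<close> consists of functions, and two
  such functions denote the same element of \<open>L\<^sup>p\<close> iff they agree almost everywhere.  An everywhere
  finite-valued representative always exists, so complex-valued functions suffice for \<open>L\<^sup>0\<close>.
  The exponent \<open>p\<close> is an extended number; only \<open>1 \<le> p \<le> \<infinity>\<close> is of interest.
\<close>

definition Lp_space :: "'a measure \<Rightarrow> ennreal \<Rightarrow> ('a \<Rightarrow> complex) set" where
  "Lp_space M p = {f \<in> borel_measurable M.
     if p = \<infinity> then esssup M (\<lambda>x. ennreal (norm (f x))) < \<infinity>
     else (\<integral>\<^sup>+x. ennreal (norm (f x) powr enn2real p) \<partial>M) < \<infinity>}"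

definition Lp_norm :: "'a measure \<Rightarrow> ennreal \<Rightarrow> ('a \<Rightarrow> complex) \<Rightarrow> real" where
  "Lp_norm M p f =
     (if p = \<infinity> then enn2real (esssup M (\<lambda>x. ennreal (norm (f x))))
      else enn2real (\<integral>\<^sup>+x. ennreal (norm (f x) powr enn2real p) \<partial>M) powr (1 / enn2real p))"


section \<open>Bounded operators on \<open>L\<^sup>p\<close> and their spectrum\<close>

text \<open>
  The second conjunct says that \<open>T\<close> is well defined on equivalence classes; all identities between
  elements of \<open>L\<^sup>p\<close> are almost-everywhere identities.
\<close>

definition Lp_bounded_operator ::
  "'a measure \<Rightarrow> ennreal \<Rightarrow> (('a \<Rightarrow> complex) \<Rightarrow> 'a \<Rightarrow> complex) \<Rightarrow> bool" where
  "Lp_bounded_operator M p T \<longleftrightarrow>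
     (\<forall>f\<in>Lp_space M p. T f \<in> Lp_space M p) \<and>
     (\<forall>f\<in>Lp_space M p. \<forall>g\<in>Lp_space M p. (AE x in M. f x = g x) \<longrightarrow> (AE x in M. T f x = T g x)) \<and>
     (\<forall>f\<in>Lp_space M p. \<forall>g\<in>Lp_space M p. AE x in M. T (\<lambda>y. f y + g y) x = T f x + T g x) \<and>
     (\<forall>c. \<forall>f\<in>Lp_space M p. AE x in M. T (\<lambda>y. c * f y) x = c * T f x) \<and>
     (\<exists>C. \<forall>f\<in>Lp_space M p. Lp_norm M p (T f) \<le> C * Lp_norm M p f)"

definition Lp_invertible ::
  "'a measure \<Rightarrow> ennreal \<Rightarrow> (('a \<Rightarrow> complex) \<Rightarrow> 'a \<Rightarrow> complex) \<Rightarrow> bool" where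
  "Lp_invertible M p T \<longleftrightarrow>
     (\<exists>S. Lp_bounded_operator M p S \<and>
          (\<forall>f\<in>Lp_space M p. (AE x in M. S (T f) x = f x) \<and> (AE x in M. T (S f) x = f x)))"

definition Lp_spectrum ::
  "'a measure \<Rightarrow> ennreal \<Rightarrow> (('a \<Rightarrow> complex) \<Rightarrow> 'a \<Rightarrow> complex) \<Rightarrow> complex set" where
  "Lp_spectrum M p T = {l. \<not> Lp_invertible M p (\<lambda>f x. T f x - l * f x)}"

definition Lp_quasinilpotent ::
  "'a measure \<Rightarrow> ennreal \<Rightarrow> (('a \<Rightarrow> complex) \<Rightarrow> 'a \<Rightarrow> complex) \<Rightarrow> bool" where
  "Lp_quasinilpotent M p T \<longleftrightarrow> Lp_spectrum M p T = {0}"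


section \<open>Conditional expectation of complex functions\<close>

text \<open>
  A sub-\<open>\<sigma>\<close>-algebra is given, as in the library, by a measure \<open>F\<close> of which only the space and the
  measurable sets matter.  The operator is the linear extension
  \<open>E f = E (Re f)\<^sup>+ - E (Re f)\<^sup>- + \<i> (E (Im f)\<^sup>+ - E (Im f)\<^sup>-)\<close>; being a total function, it has the
  intended meaning on \<open>cond_exp_domain M F\<close> only.
\<close>

definition cond_exp_domain :: "'a measure \<Rightarrow> 'a measure \<Rightarrow> ('a \<Rightarrow> complex) set" where
  "cond_exp_domain M F = {g \<in> borel_measurable M.
     AE x in M. nn_cond_exp M F (\<lambda>y. ennreal (norm (g y))) x < \<infinity>}"

definition complex_cond_exp :: "'a measure \<Rightarrow> 'a measure \<Rightarrow> ('a \<Rightarrow> complex) \<Rightarrow> 'a \<Rightarrow> complex" where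
  "complex_cond_exp M F f =
     (\<lambda>x. Complex (real_cond_exp M F (\<lambda>y. Re (f y)) x) (real_cond_exp M F (\<lambda>y. Im (f y)) x))"

definition weighted_cond_op ::
  "'a measure \<Rightarrow> 'a measure \<Rightarrow> ('a \<Rightarrow> complex) \<Rightarrow> ('a \<Rightarrow> complex) \<Rightarrow> ('a \<Rightarrow> complex) \<Rightarrow> 'a \<Rightarrow> complex" where
  "weighted_cond_op M F w u f = (\<lambda>x. w x * complex_cond_exp M F (\<lambda>y. u y * f y) x)"

end

theory Submission
  imports Defs
begin

text \<open>
  Put \<open>g = E(uw)\<close> and \<open>T = M\<^sub>w E M\<^sub>u\<close>. Pulling the \<open>\<A>\<close>-measurable factor \<open>a E(uf)\<close> out of the
  conditional expectation gives \<open>T (a T f) = a g T f\<close> for \<open>\<A>\<close>-measurable \<open>a\<close>, in particular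
  \<open>T\<^sup>2 = M\<^sub>g T\<close>. If \<open>g = 0\<close> then \<open>T\<^sup>2 = 0\<close>, so \<open>T\<close> is not invertible while the inverse of \<open>T - l\<close> is
  \<open>- l\<^sup>-\<^sup>1 - l\<^sup>-\<^sup>2 T\<close> for \<open>l \<noteq> 0\<close>. Otherwise \<open>g\<close> has an essential value \<open>l \<noteq> 0\<close>, and with \<open>a\<close> the indicator of
  \<open>{|g - l| < e}\<close> the functions \<open>h = a T f\<close> satisfy \<open>|(T - l) h| \<le> e |h|\<close>, so that they vanish for small
  \<open>e\<close> when \<open>T - l\<close> has a bounded inverse. Finally \<open>a T f = 0\<close> for all \<open>f\<close> forces \<open>a g = 0\<close>, which
  contradicts the choice of \<open>l\<close> and, for \<open>a = g\<close>, also proves that (c) implies (b).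
\<close>

section \<open>Estimates in \<open>L\<^sup>p\<close>\<close>

lemma Lp_space_measurable: "f \<in> Lp_space M p \<Longrightarrow> f \<in> borel_measurable M"
  by (simp add: Lp_space_def)

text \<open>The essential supremum and the integral of powers are both monotone. Scalar multiples,
  cut-offs (with \<open>c = 1\<close>) and the comparison of norms of functions equal almost
  everywhere are instances.\<close>

lemma Lp_dominated:
  assumes g: "g \<in> Lp_space M p" and f[measurable]: "f \<in> borel_measurable M"
    and "0 \<le> c" and le: "AE x in M. norm (f x) \<le> c * norm (g x)" and p: "1 \<le> p"
  shows "f \<in> Lp_space M p" "Lp_norm M p f \<le> c * Lp_norm M p g"
proof -
  have g'[measurable]: "g \<in> borel_measurable M" using g by (rule Lp_space_measurable)
  have "f \<in> Lp_space M p \<and> Lp_norm M p f \<le> c * Lp_norm M p g"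
  proof (cases "p = \<infinity>")
    case True
    let ?e = "esssup M (\<lambda>x. ennreal (norm (g x)))"
    have fin: "?e < \<infinity>" using g True by (simp add: Lp_space_def)
    have "AE x in M. ennreal (norm (f x)) \<le> ennreal c * ?e"
      using le esssup_AE[of "\<lambda>x. ennreal (norm (g x))" M]
    proof eventually_elim
      case (elim x)
      have "ennreal (norm (f x)) \<le> ennreal (c * norm (g x))" using elim by (simp add: ennreal_leI)
      also have "\<dots> \<le> ennreal c * ?e" using elim \<open>0 \<le> c\<close> by (simp add: ennreal_mult mult_left_mono)
      finally show ?case .
    qed
    then have *: "esssup M (\<lambda>x. ennreal (norm (f x))) \<le> ennreal c * ?e"
      by (intro esssup_I) auto
    have fin': "ennreal c * ?e < \<infinity>" using fin by (simp add: ennreal_mult_less_top)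
    have "enn2real (esssup M (\<lambda>x. ennreal (norm (f x)))) \<le> enn2real (ennreal c * ?e)"
      using * fin' by (simp add: enn2real_mono)
    then show ?thesis
      using * fin' True \<open>0 \<le> c\<close> by (auto simp: Lp_space_def Lp_norm_def enn2real_mult)
  next
    case False
    define r where "r = enn2real p"
    have r: "1 \<le> r"
      using enn2real_mono[of 1 p] p False by (simp add: r_def less_top)
    let ?I = "\<integral>\<^sup>+x. ennreal (norm (g x) powr r) \<partial>M"
    have fin: "?I < \<infinity>" using g False by (simp add: Lp_space_def r_def)
    have "(\<integral>\<^sup>+x. ennreal (norm (f x) powr r) \<partial>M)
        \<le> (\<integral>\<^sup>+x. ennreal (c powr r) * ennreal (norm (g x) powr r) \<partial>M)"
    proof (rule nn_integral_mono_AE)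
      show "AE x in M. ennreal (norm (f x) powr r) \<le> ennreal (c powr r) * ennreal (norm (g x) powr r)"
        using le
      proof eventually_elim
        case (elim x)
        have "norm (f x) powr r \<le> (c * norm (g x)) powr r"
          using elim r by (intro powr_mono2) auto
        then show ?case
          using \<open>0 \<le> c\<close> by (simp add: powr_mult ennreal_mult[symmetric] ennreal_leI)
      qed
    qed
    also have "\<dots> = ennreal (c powr r) * ?I" by (rule nn_integral_cmult) simp
    finally have *: "(\<integral>\<^sup>+x. ennreal (norm (f x) powr r) \<partial>M) \<le> ennreal (c powr r) * ?I" .
    have fin': "ennreal (c powr r) * ?I < \<infinity>" using fin by (simp add: ennreal_mult_less_top)
    have "enn2real (\<integral>\<^sup>+x. ennreal (norm (f x) powr r) \<partial>M) \<le> c powr r * enn2real ?I"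
      using enn2real_mono[OF *] fin' by (simp add: enn2real_mult)
    then have "enn2real (\<integral>\<^sup>+x. ennreal (norm (f x) powr r) \<partial>M) powr (1 / r)
        \<le> (c powr r * enn2real ?I) powr (1 / r)"
      using r by (intro powr_mono2) auto
    also have "\<dots> = c * enn2real ?I powr (1 / r)"
      using r \<open>0 \<le> c\<close> by (simp add: powr_mult powr_powr)
    finally show ?thesis
      using * fin' False by (auto simp: Lp_space_def Lp_norm_def r_def)
  qed
  then show "f \<in> Lp_space M p" "Lp_norm M p f \<le> c * Lp_norm M p g" by auto
qed

lemma Lp_cmult:
  assumes "f \<in> Lp_space M p" "1 \<le> p"
  shows "(\<lambda>x. c * f x) \<in> Lp_space M p" "Lp_norm M p (\<lambda>x. c * f x) \<le> norm c * Lp_norm M p f"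
  using assms Lp_dominated[OF assms(1), of "\<lambda>x. c * f x" "norm c"]
  by (auto simp: norm_mult dest: Lp_space_measurable)

text \<open>Boundedness of the resolvent needs no sharper constant, so Minkowski's inequality is avoided.\<close>

lemma Lp_add_quasi_triangle:
  assumes f: "f \<in> Lp_space M p" and g: "g \<in> Lp_space M p" and p: "1 \<le> p"
  shows "(\<lambda>x. f x + g x) \<in> Lp_space M p"
    "Lp_norm M p (\<lambda>x. f x + g x) \<le> 4 * (Lp_norm M p f + Lp_norm M p g)"
proof -
  have [measurable]: "f \<in> borel_measurable M" "g \<in> borel_measurable M"
    using f g by (auto dest: Lp_space_measurable)
  have "(\<lambda>x. f x + g x) \<in> Lp_space M p
      \<and> Lp_norm M p (\<lambda>x. f x + g x) \<le> 4 * (Lp_norm M p f + Lp_norm M p g)"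
  proof (cases "p = \<infinity>")
    case True
    let ?e = "esssup M (\<lambda>x. ennreal (norm (f x)))" and ?d = "esssup M (\<lambda>x. ennreal (norm (g x)))"
    have fin: "?e < \<infinity>" "?d < \<infinity>" using f g True by (simp_all add: Lp_space_def)
    have "AE x in M. ennreal (norm (f x + g x)) \<le> ?e + ?d"
      using esssup_AE[of "\<lambda>x. ennreal (norm (f x))" M] esssup_AE[of "\<lambda>x. ennreal (norm (g x))" M]
    proof eventually_elim
      case (elim x)
      have "ennreal (norm (f x + g x)) \<le> ennreal (norm (f x)) + ennreal (norm (g x))"
        by (simp add: ennreal_plus[symmetric] norm_triangle_ineq del: ennreal_plus)
      also have "\<dots> \<le> ?e + ?d" using elim by (intro add_mono)
      finally show ?case .
    qed
    then have *: "esssup M (\<lambda>x. ennreal (norm (f x + g x))) \<le> ?e + ?d"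
      by (intro esssup_I) auto
    then have "enn2real (esssup M (\<lambda>x. ennreal (norm (f x + g x)))) \<le> enn2real ?e + enn2real ?d"
      using enn2real_mono[OF *] fin by (simp add: enn2real_plus)
    also have "\<dots> \<le> 4 * (enn2real ?e + enn2real ?d)" by simp
    finally show ?thesis
      using * fin True by (auto simp: Lp_space_def Lp_norm_def intro: le_less_trans)
  next
    case False
    define r where "r = enn2real p"
    have r: "1 \<le> r"
      using enn2real_mono[of 1 p] p False by (simp add: r_def less_top)
    let ?I = "\<lambda>h. \<integral>\<^sup>+x. ennreal (norm (h x) powr r) \<partial>M"
    have fin: "?I f < \<infinity>" "?I g < \<infinity>" using f g False by (simp_all add: Lp_space_def r_def)
    \<comment> \<open>With the maximum instead of the sum, \<open>?I f + ?I g\<close> is at most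
      \<open>2 * m\<close>, and \<open>m powr (1 / r)\<close> is the corresponding root for
      \<open>f\<close> or for \<open>g\<close>. The factor 4 is the 2 from \<open>pw\<close> times
      the bound 2 for \<open>2 powr (1 / r)\<close>.\<close>
    define m where "m = max (enn2real (?I f)) (enn2real (?I g))"
    have pw: "norm (f x + g x) powr r \<le> 2 powr r * (norm (f x) powr r + norm (g x) powr r)" for x
    proof -
      have "norm (f x + g x) powr r \<le> (2 * max (norm (f x)) (norm (g x))) powr r"
        using norm_triangle_ineq[of "f x" "g x"] r by (intro powr_mono2) auto
      also have "\<dots> = 2 powr r * max (norm (f x)) (norm (g x)) powr r"
        by (simp add: powr_mult)
      also have "\<dots> \<le> 2 powr r * (norm (f x) powr r + norm (g x) powr r)"
        by (intro mult_left_mono) (auto simp: max_def)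
      finally show ?thesis .
    qed
    have "?I (\<lambda>x. f x + g x)
        \<le> (\<integral>\<^sup>+x. ennreal (2 powr r) * (ennreal (norm (f x) powr r) + ennreal (norm (g x) powr r)) \<partial>M)"
      using pw by (intro nn_integral_mono) (simp add: ennreal_plus[symmetric] ennreal_mult[symmetric] ennreal_leI del: ennreal_plus)
    also have "\<dots> = ennreal (2 powr r) * (?I f + ?I g)"
      by (simp add: nn_integral_cmult nn_integral_add)
    finally have *: "?I (\<lambda>x. f x + g x) \<le> ennreal (2 powr r) * (?I f + ?I g)" .
    have fin': "ennreal (2 powr r) * (?I f + ?I g) < \<infinity>"
      using fin by (simp add: ennreal_mult_less_top)
    have "enn2real (?I (\<lambda>x. f x + g x)) \<le> 2 powr r * (enn2real (?I f) + enn2real (?I g))"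
      using enn2real_mono[OF *] fin' fin by (simp add: enn2real_mult enn2real_plus)
    also have "\<dots> \<le> 2 powr r * (2 * m)" by (intro mult_left_mono) (auto simp: m_def)
    finally have "enn2real (?I (\<lambda>x. f x + g x)) powr (1 / r) \<le> (2 powr r * (2 * m)) powr (1 / r)"
      using r by (intro powr_mono2) auto
    also have "\<dots> = 2 * (2 powr (1 / r) * m powr (1 / r))"
      using r by (simp add: powr_mult powr_powr m_def)
    also have "\<dots> \<le> 2 * (2 * m powr (1 / r))"
      using r powr_mono[of "1 / r" 1 2] by (intro mult_left_mono mult_right_mono) auto
    also have "\<dots> \<le> 4 * (enn2real (?I f) powr (1 / r) + enn2real (?I g) powr (1 / r))"
      by (auto simp: m_def max_def)
    finally show ?thesis
      using * fin' False by (auto simp: Lp_space_def Lp_norm_def r_def intro: le_less_trans)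
  qed
  then show "(\<lambda>x. f x + g x) \<in> Lp_space M p"
    "Lp_norm M p (\<lambda>x. f x + g x) \<le> 4 * (Lp_norm M p f + Lp_norm M p g)" by auto
qed

lemma Lp_norm_nonneg: "0 \<le> Lp_norm M p f"
  by (simp add: Lp_norm_def)

text \<open>Membership in \<open>Lp_space\<close> is essential: \<open>enn2real\<close> also sends
  infinity to 0, so a vanishing \<open>Lp_norm\<close> alone proves nothing.\<close>

lemma Lp_norm_eq_0_imp_AE:
  assumes f: "f \<in> Lp_space M p" and p: "1 \<le> p" and 0: "Lp_norm M p f = 0"
  shows "AE x in M. f x = 0"
proof -
  have [measurable]: "f \<in> borel_measurable M" using f by (rule Lp_space_measurable)
  show ?thesis
  proof (cases "p = \<infinity>")
    case True
    then have "esssup M (\<lambda>x. ennreal (norm (f x))) = 0"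
      using f 0 by (auto simp: Lp_space_def Lp_norm_def enn2real_eq_0_iff)
    then show ?thesis using esssup_AE[of "\<lambda>x. ennreal (norm (f x))" M] by simp
  next
    case False
    then have "(\<integral>\<^sup>+x. ennreal (norm (f x) powr enn2real p) \<partial>M) = 0"
      using f 0 by (auto simp: Lp_space_def Lp_norm_def enn2real_eq_0_iff)
    then have "AE x in M. ennreal (norm (f x) powr enn2real p) = 0"
      by (subst (asm) nn_integral_0_iff_AE) auto
    then show ?thesis by eventually_elim (auto simp: ennreal_eq_0_iff)
  qed
qed

section \<open>Strictly positive functions and essential values\<close>

text \<open>For finite \<open>p\<close>, sigma-finiteness provides a strictly positive integrable
  function, and its root of order \<open>p\<close> works; for \<open>p = \<infinity>\<close> the
  constant 1 does. The result seeds the test function for \<open>T\<close> and serves as a nonzero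
  vector.\<close>

lemma (in sigma_finite_measure) exists_positive_Lp:
  assumes p: "1 \<le> p"
  obtains f :: "'a \<Rightarrow> real" where "f \<in> borel_measurable M" "\<And>x. 0 \<le> f x"
    "\<And>x. x \<in> space M \<Longrightarrow> 0 < f x" "(\<lambda>x. complex_of_real (f x)) \<in> Lp_space M p"
proof (cases "p = \<infinity>")
  case True
  have "esssup M (\<lambda>x. ennreal (norm (complex_of_real 1))) \<le> 1"
    by (intro esssup_I) auto
  then have "(\<lambda>x. complex_of_real 1) \<in> Lp_space M p"
    using True by (auto simp: Lp_space_def intro: le_less_trans)
  then show thesis by (intro that[of "\<lambda>x. 1"]) auto
next
  case False
  define r where "r = enn2real p"
  have r: "1 \<le> r"
    using enn2real_mono[of 1 p] p False by (simp add: r_def less_top)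
  obtain h where h[measurable]: "h \<in> borel_measurable M" and fin: "integral\<^sup>N M h \<noteq> \<infinity>"
    and pos: "\<And>x. x \<in> space M \<Longrightarrow> 0 < h x \<and> h x < \<infinity>"
    using Ex_finite_integrable_function by blast
  define f where "f = (\<lambda>x. enn2real (h x) powr (1 / r))"
  have "(\<integral>\<^sup>+x. ennreal (norm (complex_of_real (f x)) powr r) \<partial>M) = integral\<^sup>N M h"
    using pos r by (intro nn_integral_cong) (auto simp: f_def powr_powr)
  then have "(\<lambda>x. complex_of_real (f x)) \<in> Lp_space M p"
    using fin False by (auto simp: Lp_space_def r_def[symmetric] f_def less_top)
  moreover have "0 < f x" if "x \<in> space M" for x
    using pos[OF that] r by (auto simp: f_def enn2real_eq_0_iff)
  ultimately show thesis by (intro that[of f]) (auto simp: f_def)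
qed

text \<open>Otherwise every nonzero point has a ball that \<open>h\<close> avoids almost everywhere.
  By Lindelof countably many of these balls cover the complement of 0, so \<open>h\<close> vanishes
  almost everywhere.\<close>

lemma exists_essential_value:
  fixes h :: "'a \<Rightarrow> complex"
  assumes h0: "\<not> (AE x in M. h x = 0)"
  obtains l where "l \<noteq> 0" "\<And>e. e > 0 \<Longrightarrow> \<not> (AE x in M. h x \<notin> ball l e)"
proof -
  have "\<exists>l. l \<noteq> 0 \<and> (\<forall>e>0. \<not> (AE x in M. h x \<notin> ball l e))"
  proof (rule ccontr)
    assume "\<not> ?thesis"
    then have "\<forall>l. \<exists>e. l \<noteq> 0 \<longrightarrow> e > 0 \<and> (AE x in M. h x \<notin> ball l e)" by blast
    from choice[OF this] obtain e where e: "\<And>l. l \<noteq> 0 \<Longrightarrow> e l > 0 \<and> (AE x in M. h x \<notin> ball l (e l))"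
      by blast
    define \<B> where "\<B> = (\<lambda>l. ball l (e l)) ` (- {0})"
    obtain \<F> where \<F>: "\<F> \<subseteq> \<B>" "countable \<F>" "\<Union>\<F> = \<Union>\<B>"
      by (rule Lindelof[of \<B>]) (auto simp: \<B>_def)
    have "AE x in M. h x \<notin> B" if B: "B \<in> \<F>" for B
    proof -
      obtain l where "l \<noteq> 0" "B = ball l (e l)" using B \<F>(1) by (auto simp: \<B>_def)
      then show ?thesis using e by blast
    qed
    then have "AE x in M. \<forall>B\<in>\<F>. h x \<notin> B"
      using \<F>(2) by (simp add: AE_ball_countable)
    then have "AE x in M. h x = 0"
    proof eventually_elim
      case (elim x)
      then have "h x \<notin> \<Union>\<B>" unfolding \<F>(3)[symmetric] by blast
      moreover have "h x \<in> ball (h x) (e (h x))" if "h x \<noteq> 0"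
        using e[OF that] by simp
      ultimately show "h x = 0" unfolding \<B>_def by blast
    qed
    with h0 show False ..
  qed
  then show thesis using that by blast
qed

section \<open>Conditional expectation of non-integrable functions\<close>

context sigma_finite_subalgebra
begin

section \<open>Real-valued functions\<close>

text \<open>The point is that \<open>a\<close> and \<open>b\<close> need not be the positive and
  negative parts of \<open>a - b\<close>: the value is the same for every decomposition into
  nonnegative functions with finite conditional expectation.\<close>

lemma real_cond_exp_diff_nonneg:
  assumes [measurable]: "a \<in> borel_measurable M" "b \<in> borel_measurable M"
    and nn: "\<And>x. 0 \<le> a x" "\<And>x. 0 \<le> b x"
    and fin: "AE x in M. nn_cond_exp M F (\<lambda>y. ennreal (a y)) x < \<infinity>"
      "AE x in M. nn_cond_exp M F (\<lambda>y. ennreal (b y)) x < \<infinity>"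
  shows "AE x in M. real_cond_exp M F (\<lambda>y. a y - b y) x
      = enn2real (nn_cond_exp M F (\<lambda>y. ennreal (a y)) x) - enn2real (nn_cond_exp M F (\<lambda>y. ennreal (b y)) x)"
proof -
  let ?P = "\<lambda>y. ennreal (a y - b y)" and ?N = "\<lambda>y. ennreal (- (a y - b y))"
  \<comment> \<open>Both sides are the maximum of \<open>a\<close> and \<open>b\<close>. Taking
    conditional expectations turns this into an identity of sums, whose terms are finite because
    \<open>?P\<close> is below \<open>a\<close> and \<open>?N\<close> below \<open>b\<close>, so
    that they can be rearranged.\<close>
  have eq: "(\<lambda>x. ?P x + ennreal (b x)) = (\<lambda>x. ?N x + ennreal (a x))"
  proof
    fix x show "?P x + ennreal (b x) = ?N x + ennreal (a x)"
      using nn[of x] by (cases "a x \<le> b x") (simp_all add: ennreal_neg ennreal_plus[symmetric] del: ennreal_plus)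
  qed
  have "AE x in M. nn_cond_exp M F ?P x \<le> nn_cond_exp M F (\<lambda>y. ennreal (a y)) x"
    using nn by (intro nn_cond_exp_mono) (auto intro!: ennreal_leI)
  moreover have "AE x in M. nn_cond_exp M F ?N x \<le> nn_cond_exp M F (\<lambda>y. ennreal (b y)) x"
    using nn by (intro nn_cond_exp_mono) (auto intro!: ennreal_leI)
  moreover have "AE x in M. nn_cond_exp M F ?P x + nn_cond_exp M F (\<lambda>y. ennreal (b y)) x
      = nn_cond_exp M F (\<lambda>x. ?P x + ennreal (b x)) x"
    by (rule nn_cond_exp_sum) auto
  moreover have "AE x in M. nn_cond_exp M F ?N x + nn_cond_exp M F (\<lambda>y. ennreal (a y)) x
      = nn_cond_exp M F (\<lambda>x. ?P x + ennreal (b x)) x"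
    unfolding eq by (rule nn_cond_exp_sum) auto
  ultimately show ?thesis using fin
  proof eventually_elim
    case (elim x)
    have fin': "nn_cond_exp M F ?P x < \<top>" "nn_cond_exp M F ?N x < \<top>"
      using elim(1,2,5,6) by (auto intro: le_less_trans)
    have "enn2real (nn_cond_exp M F ?P x + nn_cond_exp M F (\<lambda>y. ennreal (b y)) x)
        = enn2real (nn_cond_exp M F ?N x + nn_cond_exp M F (\<lambda>y. ennreal (a y)) x)"
      unfolding elim(3,4) ..
    with fin' elim(5,6) show ?case
      unfolding real_cond_exp_def infinity_ennreal_def by (subst (asm) (1 2) enn2real_plus) linarith+
  qed
qed

text \<open>The function \<open>f\<close> may change sign, since \<open>ennreal\<close> cuts off
  negative values and a factor \<open>a \<ge> 0\<close> respects the cut. Hence this applies to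
  \<open>f\<close> and \<open>- f\<close>, the two halves of \<open>real_cond_exp\<close>.\<close>

lemma nn_cond_exp_prod_finite:
  assumes a[measurable]: "a \<in> borel_measurable F" and f[measurable]: "f \<in> borel_measurable M"
    and fin: "AE x in M. nn_cond_exp M F (\<lambda>y. ennreal (f y)) x < \<infinity>"
    and nn: "\<And>x. 0 \<le> a x"
  shows "AE x in M. nn_cond_exp M F (\<lambda>y. ennreal (a y * f y)) x < \<infinity>
    \<and> enn2real (nn_cond_exp M F (\<lambda>y. ennreal (a y * f y)) x)
      = a x * enn2real (nn_cond_exp M F (\<lambda>y. ennreal (f y)) x)"
proof -
  have split_eq: "(\<lambda>y. ennreal (a y * f y)) = (\<lambda>y. ennreal (a y) * ennreal (f y))"
    using nn by (auto simp: ennreal_mult')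
  have "AE x in M. ennreal (a x) * nn_cond_exp M F (\<lambda>y. ennreal (f y)) x
      = nn_cond_exp M F (\<lambda>y. ennreal (a y) * ennreal (f y)) x"
    by (rule nn_cond_exp_prod) auto
  then show ?thesis using fin
    unfolding split_eq
  proof eventually_elim
    case (elim x)
    show ?case
      unfolding elim(1)[symmetric] using elim(2) nn[of x]
      by (auto simp: ennreal_mult_less_top enn2real_mult)
  qed
qed

lemma nn_cond_exp_add_finite:
  assumes [measurable]: "f \<in> borel_measurable M" "g \<in> borel_measurable M"
    and nn: "\<And>x. 0 \<le> f x" "\<And>x. 0 \<le> g x"
    and fin: "AE x in M. nn_cond_exp M F (\<lambda>y. ennreal (f y)) x < \<infinity>"
      "AE x in M. nn_cond_exp M F (\<lambda>y. ennreal (g y)) x < \<infinity>"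
  shows "AE x in M. nn_cond_exp M F (\<lambda>y. ennreal (f y + g y)) x < \<infinity>
    \<and> enn2real (nn_cond_exp M F (\<lambda>y. ennreal (f y + g y)) x)
      = enn2real (nn_cond_exp M F (\<lambda>y. ennreal (f y)) x) + enn2real (nn_cond_exp M F (\<lambda>y. ennreal (g y)) x)"
proof -
  have split_eq: "(\<lambda>y. ennreal (f y + g y)) = (\<lambda>y. ennreal (f y) + ennreal (g y))"
    using nn by auto
  have "AE x in M. nn_cond_exp M F (\<lambda>y. ennreal (f y)) x + nn_cond_exp M F (\<lambda>y. ennreal (g y)) x
      = nn_cond_exp M F (\<lambda>y. ennreal (f y) + ennreal (g y)) x"
    by (rule nn_cond_exp_sum) auto
  then show ?thesis using fin
    unfolding split_eq
  proof eventually_elim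
    case (elim x)
    show ?case
      unfolding elim(1)[symmetric] using elim(2,3) by (auto simp: enn2real_plus)
  qed
qed

lemma nn_cond_exp_finite_mono:
  assumes [measurable]: "f \<in> borel_measurable M" "g \<in> borel_measurable M"
    and "\<And>x. f x \<le> g x" and fin: "AE x in M. nn_cond_exp M F g x < \<infinity>"
  shows "AE x in M. nn_cond_exp M F f x < \<infinity>"
proof -
  have "AE x in M. nn_cond_exp M F f x \<le> nn_cond_exp M F g x"
    using assms(3) by (intro nn_cond_exp_mono) auto
  then show ?thesis using fin by eventually_elim (rule le_less_trans)
qed

text \<open>With positive and negative parts, \<open>f - g\<close> regroups as
  \<open>(fp + gm) - (fm + gp)\<close>, a difference of nonnegative functions. Finite conditional
  expectations of the absolute values take the place of integrability.\<close>

lemma real_cond_exp_diff_extended: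
  fixes f g :: "'a \<Rightarrow> real"
  assumes f[measurable]: "f \<in> borel_measurable M" and g[measurable]: "g \<in> borel_measurable M"
    and fin: "AE x in M. nn_cond_exp M F (\<lambda>y. ennreal \<bar>f y\<bar>) x < \<infinity>"
      "AE x in M. nn_cond_exp M F (\<lambda>y. ennreal \<bar>g y\<bar>) x < \<infinity>"
  shows "AE x in M. real_cond_exp M F (\<lambda>y. f y - g y) x = real_cond_exp M F f x - real_cond_exp M F g x"
proof -
  define fp fm gp gm where "fp x = max 0 (f x)" and "fm x = max 0 (- f x)"
    and "gp x = max 0 (g x)" and "gm x = max 0 (- g x)" for x
  have [measurable]: "fp \<in> borel_measurable M" "fm \<in> borel_measurable M"
    "gp \<in> borel_measurable M" "gm \<in> borel_measurable M"
    unfolding fp_def[abs_def] fm_def[abs_def] gp_def[abs_def] gm_def[abs_def] by measurable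
  have nn: "0 \<le> fp x" "0 \<le> fm x" "0 \<le> gp x" "0 \<le> gm x" for x
    by (auto simp: fp_def fm_def gp_def gm_def)
  have *: "AE x in M. nn_cond_exp M F (\<lambda>y. ennreal (fp y)) x < \<infinity>"
    "AE x in M. nn_cond_exp M F (\<lambda>y. ennreal (fm y)) x < \<infinity>"
    by (rule nn_cond_exp_finite_mono[OF _ _ _ fin(1)]; auto intro!: ennreal_leI simp: fp_def fm_def)+
  have **: "AE x in M. nn_cond_exp M F (\<lambda>y. ennreal (gp y)) x < \<infinity>"
    "AE x in M. nn_cond_exp M F (\<lambda>y. ennreal (gm y)) x < \<infinity>"
    by (rule nn_cond_exp_finite_mono[OF _ _ _ fin(2)]; auto intro!: ennreal_leI simp: gp_def gm_def)+
  have 1: "AE x in M. nn_cond_exp M F (\<lambda>y. ennreal (fp y + gm y)) x < \<infinity>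
    \<and> enn2real (nn_cond_exp M F (\<lambda>y. ennreal (fp y + gm y)) x)
      = enn2real (nn_cond_exp M F (\<lambda>y. ennreal (fp y)) x) + enn2real (nn_cond_exp M F (\<lambda>y. ennreal (gm y)) x)"
    using nn * ** by (intro nn_cond_exp_add_finite) auto
  have 2: "AE x in M. nn_cond_exp M F (\<lambda>y. ennreal (fm y + gp y)) x < \<infinity>
    \<and> enn2real (nn_cond_exp M F (\<lambda>y. ennreal (fm y + gp y)) x)
      = enn2real (nn_cond_exp M F (\<lambda>y. ennreal (fm y)) x) + enn2real (nn_cond_exp M F (\<lambda>y. ennreal (gp y)) x)"
    using nn * ** by (intro nn_cond_exp_add_finite) auto
  have eq: "f y - g y = (fp y + gm y) - (fm y + gp y)" "f y = fp y - fm y" "g y = gp y - gm y" for y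
    by (auto simp: fp_def fm_def gp_def gm_def)
  have "AE x in M. real_cond_exp M F (\<lambda>y. (fp y + gm y) - (fm y + gp y)) x
      = enn2real (nn_cond_exp M F (\<lambda>y. ennreal (fp y + gm y)) x)
      - enn2real (nn_cond_exp M F (\<lambda>y. ennreal (fm y + gp y)) x)"
    using 1 2 nn by (intro real_cond_exp_diff_nonneg) auto
  moreover have "AE x in M. real_cond_exp M F (\<lambda>y. fp y - fm y) x
      = enn2real (nn_cond_exp M F (\<lambda>y. ennreal (fp y)) x) - enn2real (nn_cond_exp M F (\<lambda>y. ennreal (fm y)) x)"
    using * nn by (intro real_cond_exp_diff_nonneg) auto
  moreover have "AE x in M. real_cond_exp M F (\<lambda>y. gp y - gm y) x
      = enn2real (nn_cond_exp M F (\<lambda>y. ennreal (gp y)) x) - enn2real (nn_cond_exp M F (\<lambda>y. ennreal (gm y)) x)"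
    using ** nn by (intro real_cond_exp_diff_nonneg) auto
  ultimately show ?thesis
    using 1 2 unfolding eq(1) eq(2)[symmetric] eq(3)[symmetric]
    by eventually_elim simp
qed

text \<open>A nonnegative factor can be pulled out of both halves of \<open>real_cond_exp\<close>; a
  general one is split into its positive and negative parts. The first conclusion allows such
  products to be subtracted from each other afterwards.\<close>

lemma real_cond_exp_mult_extended:
  fixes a f :: "'a \<Rightarrow> real"
  assumes a[measurable]: "a \<in> borel_measurable F" and f[measurable]: "f \<in> borel_measurable M"
    and fin: "AE x in M. nn_cond_exp M F (\<lambda>y. ennreal \<bar>f y\<bar>) x < \<infinity>"
  shows "AE x in M. nn_cond_exp M F (\<lambda>y. ennreal \<bar>a y * f y\<bar>) x < \<infinity>"
    "AE x in M. real_cond_exp M F (\<lambda>y. a y * f y) x = a x * real_cond_exp M F f x"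
proof -
  have [measurable]: "a \<in> borel_measurable M" by (rule measurable_from_subalg[OF subalg a])
  have *: "AE x in M. nn_cond_exp M F (\<lambda>y. ennreal (\<bar>a y\<bar> * \<bar>f y\<bar>)) x < \<infinity>
      \<and> enn2real (nn_cond_exp M F (\<lambda>y. ennreal (\<bar>a y\<bar> * \<bar>f y\<bar>)) x)
      = \<bar>a x\<bar> * enn2real (nn_cond_exp M F (\<lambda>y. ennreal \<bar>f y\<bar>) x)"
    using fin by (intro nn_cond_exp_prod_finite) auto
  then show fin1: "AE x in M. nn_cond_exp M F (\<lambda>y. ennreal \<bar>a y * f y\<bar>) x < \<infinity>"
    by (simp add: abs_mult)
  have nonneg: "AE x in M. real_cond_exp M F (\<lambda>y. b y * f y) x = b x * real_cond_exp M F f x"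
    if b[measurable]: "b \<in> borel_measurable F" and nn: "\<And>x. 0 \<le> b x" for b
  proof -
    have "AE x in M. nn_cond_exp M F (\<lambda>y. ennreal (f y)) x < \<infinity>"
      "AE x in M. nn_cond_exp M F (\<lambda>y. ennreal (- f y)) x < \<infinity>"
      by (rule nn_cond_exp_finite_mono[OF _ _ _ fin]; auto intro!: ennreal_leI)+
    from nn_cond_exp_prod_finite[OF b f this(1) nn] nn_cond_exp_prod_finite[OF b _ this(2) nn]
    have "AE x in M. enn2real (nn_cond_exp M F (\<lambda>y. ennreal (b y * f y)) x)
        = b x * enn2real (nn_cond_exp M F (\<lambda>y. ennreal (f y)) x)"
      "AE x in M. enn2real (nn_cond_exp M F (\<lambda>y. ennreal (b y * - f y)) x)
        = b x * enn2real (nn_cond_exp M F (\<lambda>y. ennreal (- f y)) x)"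
      by auto
    then show ?thesis
      by eventually_elim (simp add: real_cond_exp_def algebra_simps)
  qed
  let ?p = "\<lambda>y. max 0 (a y)" and ?m = "\<lambda>y. max 0 (- a y)"
  have fin2: "AE x in M. nn_cond_exp M F (\<lambda>y. ennreal \<bar>?p y * f y\<bar>) x < \<infinity>"
    "AE x in M. nn_cond_exp M F (\<lambda>y. ennreal \<bar>?m y * f y\<bar>) x < \<infinity>"
    by (rule nn_cond_exp_finite_mono[OF _ _ _ fin1]; auto intro!: ennreal_leI simp: max_def)+
  have eq: "(\<lambda>y. a y * f y) = (\<lambda>y. ?p y * f y - ?m y * f y)"
    by (auto simp: max_def)
  have "AE x in M. real_cond_exp M F (\<lambda>y. ?p y * f y - ?m y * f y) x
      = real_cond_exp M F (\<lambda>y. ?p y * f y) x - real_cond_exp M F (\<lambda>y. ?m y * f y) x"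
    using fin2 by (intro real_cond_exp_diff_extended) auto
  moreover have "AE x in M. real_cond_exp M F (\<lambda>y. ?p y * f y) x = ?p x * real_cond_exp M F f x"
    by (rule nonneg) auto
  moreover have "AE x in M. real_cond_exp M F (\<lambda>y. ?m y * f y) x = ?m x * real_cond_exp M F f x"
    by (rule nonneg) auto
  ultimately show "AE x in M. real_cond_exp M F (\<lambda>y. a y * f y) x = a x * real_cond_exp M F f x"
    unfolding eq by eventually_elim (auto simp: max_def)
qed

section \<open>Complex-valued functions\<close>

lemma complex_cond_exp_measurable [measurable]:
  "complex_cond_exp M F f \<in> borel_measurable F" "complex_cond_exp M F f \<in> borel_measurable M"
proof -
  show *: "complex_cond_exp M F f \<in> borel_measurable F"
    unfolding complex_cond_exp_def borel_measurable_complex_iff by simp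
  show "complex_cond_exp M F f \<in> borel_measurable M"
    by (rule measurable_from_subalg[OF subalg *])
qed

lemma complex_cond_exp_cong:
  assumes "AE x in M. f x = g x"
    and [measurable]: "f \<in> borel_measurable M" "g \<in> borel_measurable M"
  shows "AE x in M. complex_cond_exp M F f x = complex_cond_exp M F g x"
proof -
  have "AE x in M. nn_cond_exp M F (\<lambda>y. ennreal (h (f y))) x = nn_cond_exp M F (\<lambda>y. ennreal (h (g y))) x"
    if [measurable]: "h \<in> borel_measurable borel" for h :: "complex \<Rightarrow> real"
    using assms(1) by (intro nn_cond_exp_cong) auto
  from this[of Re] this[of "\<lambda>z. - Re z"] this[of Im] this[of "\<lambda>z. - Im z"]
  show ?thesis
    unfolding complex_cond_exp_def real_cond_exp_def by simp (auto elim: eventually_elim2)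
qed

text \<open>This holds at every point and without finiteness: for the zero imaginary part the two
  halves of \<open>real_cond_exp\<close> are the same function and cancel.\<close>

lemma complex_cond_exp_of_real:
  "complex_cond_exp M F (\<lambda>y. complex_of_real (f y)) x = complex_of_real (real_cond_exp M F f x)"
  by (simp add: complex_cond_exp_def real_cond_exp_def complex_of_real_def)

lemma complex_cond_exp_zero: "AE x in M. complex_cond_exp M F (\<lambda>y. 0) x = 0"
  by (simp add: complex_cond_exp_def real_cond_exp_def complex_eq_iff)

lemma complex_cond_exp_mult:
  assumes a[measurable]: "a \<in> borel_measurable F" and f: "f \<in> cond_exp_domain M F"
  shows "AE x in M. complex_cond_exp M F (\<lambda>y. a y * f y) x = a x * complex_cond_exp M F f x"
proof -
  have f'[measurable]: "f \<in> borel_measurable M"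
    and fin: "AE x in M. nn_cond_exp M F (\<lambda>y. ennreal (norm (f y))) x < \<infinity>"
    using f by (auto simp: cond_exp_domain_def)
  have [measurable]: "a \<in> borel_measurable M" by (rule measurable_from_subalg[OF subalg a])
  have re: "AE x in M. nn_cond_exp M F (\<lambda>y. ennreal \<bar>Re (f y)\<bar>) x < \<infinity>"
    by (rule nn_cond_exp_finite_mono[OF _ _ _ fin]) (auto intro!: ennreal_leI abs_Re_le_cmod)
  have im: "AE x in M. nn_cond_exp M F (\<lambda>y. ennreal \<bar>Im (f y)\<bar>) x < \<infinity>"
    by (rule nn_cond_exp_finite_mono[OF _ _ _ fin]) (auto intro!: ennreal_leI abs_Im_le_cmod)
  have meas: "(\<lambda>x. Re (a x)) \<in> borel_measurable F" "(\<lambda>x. Im (a x)) \<in> borel_measurable F"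
    "(\<lambda>x. - Im (a x)) \<in> borel_measurable F"
    "(\<lambda>x. Re (f x)) \<in> borel_measurable M" "(\<lambda>x. Im (f x)) \<in> borel_measurable M"
    by measurable
  note m = real_cond_exp_mult_extended
  note rr = m[OF meas(1,4) re] m[OF meas(2,5) im] m[OF meas(1,5) im] m[OF meas(3,4) re]
  have "AE x in M. real_cond_exp M F (\<lambda>y. Re (a y) * Re (f y) - Im (a y) * Im (f y)) x
      = real_cond_exp M F (\<lambda>y. Re (a y) * Re (f y)) x - real_cond_exp M F (\<lambda>y. Im (a y) * Im (f y)) x"
    using rr by (intro real_cond_exp_diff_extended) auto
  \<comment> \<open>The double minus writes the imaginary part of the product, a sum, as a
    difference, so that \<open>real_cond_exp_diff_extended\<close> covers it too.\<close>
  moreover have "AE x in M. real_cond_exp M F (\<lambda>y. Re (a y) * Im (f y) - - Im (a y) * Re (f y)) x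
      = real_cond_exp M F (\<lambda>y. Re (a y) * Im (f y)) x - real_cond_exp M F (\<lambda>y. - Im (a y) * Re (f y)) x"
    using rr by (intro real_cond_exp_diff_extended) auto
  moreover note rr(2,4,6,8)
  ultimately show ?thesis
    unfolding complex_cond_exp_def
    by eventually_elim (simp add: complex_eq_iff)
qed

end

section \<open>The operator \<open>M\<^sub>w E M\<^sub>u\<close>\<close>

text \<open>Since \<open>complex_cond_exp\<close> is total, it is \<open>u_mult_domain\<close> that
  gives \<open>E(uf)\<close> its intended meaning for each \<open>f\<close> in the space.\<close>

locale bounded_weighted_cond_op = sigma_finite_subalgebra M F
  for M F :: "'a measure" +
  fixes p :: ennreal and u w :: "'a \<Rightarrow> complex"
  assumes u: "u \<in> cond_exp_domain M F"
    and w: "w \<in> cond_exp_domain M F"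
    and p: "1 \<le> p"
    and u_mult_domain: "\<And>f. f \<in> Lp_space M p \<Longrightarrow> (\<lambda>x. u x * f x) \<in> cond_exp_domain M F"
    and bounded: "Lp_bounded_operator M p (weighted_cond_op M F w u)"
begin

abbreviation T :: "('a \<Rightarrow> complex) \<Rightarrow> 'a \<Rightarrow> complex" where
  "T \<equiv> weighted_cond_op M F w u"

definition g :: "'a \<Rightarrow> complex" where
  "g = complex_cond_exp M F (\<lambda>y. u y * w y)"

lemma u_measurable [measurable]: "u \<in> borel_measurable M"
  and w_measurable [measurable]: "w \<in> borel_measurable M"
  using u w by (auto simp: cond_exp_domain_def)

lemma g_measurable [measurable]: "g \<in> borel_measurable F" "g \<in> borel_measurable M"
  unfolding g_def by (rule complex_cond_exp_measurable)+

lemma T_Lp: "f \<in> Lp_space M p \<Longrightarrow> T f \<in> Lp_space M p"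
  using bounded by (simp add: Lp_bounded_operator_def)

lemma T_cong:
  "\<lbrakk>f \<in> Lp_space M p; h \<in> Lp_space M p; AE x in M. f x = h x\<rbrakk> \<Longrightarrow> AE x in M. T f x = T h x"
  using bounded by (simp add: Lp_bounded_operator_def)

lemma T_add:
  "\<lbrakk>f \<in> Lp_space M p; h \<in> Lp_space M p\<rbrakk> \<Longrightarrow> AE x in M. T (\<lambda>y. f y + h y) x = T f x + T h x"
  using bounded by (simp add: Lp_bounded_operator_def)

lemma T_cmult: "f \<in> Lp_space M p \<Longrightarrow> AE x in M. T (\<lambda>y. c * f y) x = c * T f x"
  using bounded by (simp add: Lp_bounded_operator_def)

lemma T_bound:
  obtains C where "0 \<le> C" "\<And>f. f \<in> Lp_space M p \<Longrightarrow> Lp_norm M p (T f) \<le> C * Lp_norm M p f"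
proof -
  obtain C where C: "\<And>f. f \<in> Lp_space M p \<Longrightarrow> Lp_norm M p (T f) \<le> C * Lp_norm M p f"
    using bounded unfolding Lp_bounded_operator_def by blast
  have "Lp_norm M p (T f) \<le> \<bar>C\<bar> * Lp_norm M p f" if "f \<in> Lp_space M p" for f
    using C[OF that] mult_right_mono[OF abs_ge_self Lp_norm_nonneg, of C M p f] by simp
  then show thesis by (intro that[of "\<bar>C\<bar>"]) auto
qed

text \<open>
  A test function \<open>f\<close> aligned with the phase of \<open>u\<close> makes \<open>T f = k w\<close> with \<open>k = E(|u| |f|)\<close>, and \<open>k\<close>
  vanishes only where \<open>u\<close> does. As \<open>u T f = k u w\<close> has a finite conditional expectation, so has \<open>u w\<close>.
\<close>

lemma exists_test_function:
  obtains f k where "f \<in> Lp_space M p" "k \<in> borel_measurable F"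
    "AE x in M. T f x = w x * complex_of_real (k x)" "\<And>x. 0 \<le> k x"
    "AE x in M. k x = 0 \<longrightarrow> u x = 0"
proof -
  interpret sigma_finite_measure M
    using sigma_finite_subalgebra_is_sigma_finite sigma_finite_subalgebra_axioms by blast
  obtain f0 :: "'a \<Rightarrow> real" where f0[measurable]: "f0 \<in> borel_measurable M"
    and nn: "\<And>x. 0 \<le> f0 x" and pos: "\<And>x. x \<in> space M \<Longrightarrow> 0 < f0 x"
    and Lp: "(\<lambda>x. complex_of_real (f0 x)) \<in> Lp_space M p"
    using exists_positive_Lp[OF p] by blast
  define f where "f = (\<lambda>x. complex_of_real (f0 x) * cnj (sgn (u x)))"
  define K where "K = nn_cond_exp M F (\<lambda>x. ennreal (norm (u x) * f0 x))"
  define k where "k = (\<lambda>x. enn2real (K x))"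
  have [measurable]: "K \<in> borel_measurable F" "K \<in> borel_measurable M"
    unfolding K_def by simp_all
  have [measurable]: "cnj \<in> borel_measurable borel"
    by (intro borel_measurable_continuous_onI continuous_intros)
  have [measurable]: "f \<in> borel_measurable M"
    unfolding f_def sgn_div_norm by measurable
  have fLp: "f \<in> Lp_space M p"
    by (rule Lp_dominated(1)[OF Lp, of _ 1])
      (use nn p in \<open>auto simp: f_def norm_mult norm_sgn\<close>)
  have uf: "u x * f x = complex_of_real (norm (u x) * f0 x)" for x
  proof -
    have "u x * cnj (sgn (u x)) = complex_of_real ((norm (u x))\<^sup>2) / complex_of_real (norm (u x))"
      unfolding complex_norm_square by (simp add: sgn_eq)
    also have "\<dots> = complex_of_real (norm (u x))" by (simp add: power2_eq_square)
    finally show ?thesis by (simp add: f_def)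
  qed
  \<comment> \<open>Finiteness makes the zeros of \<open>k\<close> those of \<open>K\<close> almost
    everywhere, as \<open>enn2real\<close> would also send infinity to 0.\<close>
  have "AE x in M. K x < \<infinity>"
    using u_mult_domain[OF fLp] nn unfolding uf
    by (simp add: cond_exp_domain_def K_def norm_mult)
  moreover have "AE x in M. K x = 0 \<longrightarrow> u x = 0"
  proof -
    \<comment> \<open>On the set where \<open>K\<close> vanishes, which belongs to the subalgebra,
      \<open>|u| f0\<close> has the same integral as \<open>K\<close>, namely 0. As
      \<open>f0\<close> is positive, \<open>u\<close> vanishes there.\<close>
    have "(\<integral>\<^sup>+x. indicator {0} (K x) * ennreal (norm (u x) * f0 x) \<partial>M)
        = (\<integral>\<^sup>+x. indicator {0} (K x) * K x \<partial>M)"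
      unfolding K_def by (rule nn_cond_exp_intg[symmetric]) auto
    also have "\<dots> = 0"
      by (simp add: nn_integral_0_iff_AE indicator_def)
    finally have "AE x in M. indicator {0} (K x) * ennreal (norm (u x) * f0 x) = 0"
      by (subst (asm) nn_integral_0_iff_AE) auto
    then show ?thesis
      using AE_space
    proof eventually_elim
      case (elim x)
      show ?case
      proof
        assume "K x = 0"
        then have "norm (u x) * f0 x \<le> 0" using elim by (simp add: ennreal_eq_0_iff)
        then show "u x = 0" using pos[OF elim(2)] by (simp add: mult_le_0_iff)
      qed
    qed
  qed
  ultimately have "AE x in M. k x = 0 \<longrightarrow> u x = 0"
    by eventually_elim (auto simp: k_def enn2real_eq_0_iff)
  moreover have "AE x in M. T f x = w x * complex_of_real (k x)"
  proof -
    have neg: "(\<lambda>y. ennreal (- (norm (u y) * f0 y))) = (\<lambda>y. 0)"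
      using nn by (auto simp: ennreal_neg)
    have "AE x in M. 0 = nn_cond_exp M F (\<lambda>y. 0) x"
      by (rule nn_cond_exp_F_meas) auto
    then show ?thesis
      unfolding weighted_cond_op_def uf complex_cond_exp_of_real real_cond_exp_def neg
      by eventually_elim (simp add: k_def K_def)
  qed
  ultimately show thesis
    using fLp by (intro that[of f k]) (auto simp: k_def)
qed

section \<open>Finiteness of \<open>E(|uw|)\<close> and the product formula for
  \<open>T\<close>\<close>

lemma uw_domain: "(\<lambda>x. u x * w x) \<in> cond_exp_domain M F"
proof -
  obtain f k where f: "f \<in> Lp_space M p" and k[measurable]: "k \<in> borel_measurable F"
    and Tf: "AE x in M. T f x = w x * complex_of_real (k x)" and nn: "\<And>x. 0 \<le> k x"
    and k0: "AE x in M. k x = 0 \<longrightarrow> u x = 0"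
    using exists_test_function by blast
  have [measurable]: "k \<in> borel_measurable M" by (rule measurable_from_subalg[OF subalg k])
  have [measurable]: "T f \<in> borel_measurable M" using T_Lp[OF f] by (rule Lp_space_measurable)
  let ?h = "\<lambda>x. ennreal (norm (u x * w x))"
  have "AE x in M. ennreal (norm (u x * T f x)) = ennreal (k x) * ?h x"
    using Tf by eventually_elim (simp add: nn norm_mult ennreal_mult[symmetric] ac_simps)
  then have "AE x in M. nn_cond_exp M F (\<lambda>x. ennreal (norm (u x * T f x))) x
      = nn_cond_exp M F (\<lambda>x. ennreal (k x) * ?h x) x"
    by (rule nn_cond_exp_cong) auto
  moreover have "AE x in M. ennreal (k x) * nn_cond_exp M F ?h x
      = nn_cond_exp M F (\<lambda>x. ennreal (k x) * ?h x) x"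
    by (rule nn_cond_exp_prod) auto
  moreover have "AE x in M. nn_cond_exp M F (\<lambda>x. ennreal (norm (u x * T f x))) x < \<infinity>"
    using u_mult_domain[OF T_Lp[OF f]] by (simp add: cond_exp_domain_def)
  \<comment> \<open>Where \<open>k\<close> is zero one cannot divide by it. But there
    \<open>u\<close> vanishes, and the indicator of this set can be pulled out, so the conditional
    expectation of \<open>|uw|\<close> is 0.\<close>
  moreover have "AE x in M. k x = 0 \<longrightarrow> nn_cond_exp M F ?h x = 0"
  proof -
    have "AE x in M. indicator {0} (k x) * ?h x = 0"
      using k0 by eventually_elim (auto simp: indicator_def)
    then have "AE x in M. nn_cond_exp M F (\<lambda>x. indicator {0} (k x) * ?h x) x = nn_cond_exp M F (\<lambda>x. 0) x"
      by (rule nn_cond_exp_cong) auto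
    moreover have "AE x in M. indicator {0} (k x) * nn_cond_exp M F ?h x
        = nn_cond_exp M F (\<lambda>x. indicator {0} (k x) * ?h x) x"
      by (rule nn_cond_exp_prod) auto
    moreover have "AE x in M. 0 = nn_cond_exp M F (\<lambda>x. 0) x"
      by (rule nn_cond_exp_F_meas) auto
    ultimately show ?thesis by eventually_elim (auto simp: indicator_def split: if_splits)
  qed
  ultimately have "AE x in M. nn_cond_exp M F ?h x < \<infinity>"
  proof eventually_elim
    case (elim x)
    show ?case
    proof (cases "k x = 0")
      case False
      then have "ennreal (k x) \<noteq> 0" using nn[of x] by (simp add: ennreal_eq_0_iff)
      moreover have "ennreal (k x) * nn_cond_exp M F ?h x < \<infinity>" using elim(1-3) by simp
      ultimately show ?thesis by (auto simp: ennreal_mult_less_top)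
    qed (use elim in simp)
  qed
  then show ?thesis by (simp add: cond_exp_domain_def)
qed

lemma T_mult_T:
  assumes f: "f \<in> Lp_space M p" and a[measurable]: "a \<in> borel_measurable F"
  shows "AE x in M. T (\<lambda>y. a y * T f y) x = a x * g x * T f x"
proof -
  let ?e = "complex_cond_exp M F (\<lambda>y. u y * f y)"
  \<comment> \<open>The \<open>w\<close> inside \<open>T f\<close> joins \<open>u\<close>, leaving a
    factor measurable in the subalgebra. By \<open>uw_domain\<close> that factor may be pulled
    out.\<close>
  have "(\<lambda>y. u y * (a y * T f y)) = (\<lambda>y. (a y * ?e y) * (u y * w y))"
    by (auto simp: weighted_cond_op_def)
  moreover have "AE x in M. complex_cond_exp M F (\<lambda>y. (a y * ?e y) * (u y * w y)) x
      = (a x * ?e x) * complex_cond_exp M F (\<lambda>y. u y * w y) x"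
    by (rule complex_cond_exp_mult[OF _ uw_domain]) measurable
  ultimately have "AE x in M. complex_cond_exp M F (\<lambda>y. u y * (a y * T f y)) x
      = (a x * ?e x) * g x"
    by (simp add: g_def)
  then show ?thesis
    by eventually_elim (simp add: weighted_cond_op_def)
qed

lemma T_T: "f \<in> Lp_space M p \<Longrightarrow> AE x in M. T (T f) x = g x * T f x"
  using T_mult_T[of f "\<lambda>_. 1"] by simp

text \<open>If \<open>b u w = 0\<close> then \<open>b g = E(b u w) = 0\<close>. This is used twice:
  with \<open>b = a k\<close>, because the test function gives \<open>a k w = 0\<close>, and with
  \<open>b\<close> the indicator of the zeros of \<open>k\<close>, where \<open>u\<close>
  vanishes.\<close>

lemma mult_g_eq_0I:
  assumes a[measurable]: "a \<in> borel_measurable F"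
    and 0: "\<And>f. f \<in> Lp_space M p \<Longrightarrow> AE x in M. a x * T f x = 0"
  shows "AE x in M. a x * g x = 0"
proof -
  obtain f k where f: "f \<in> Lp_space M p" and k[measurable]: "k \<in> borel_measurable F"
    and Tf: "AE x in M. T f x = w x * complex_of_real (k x)" and nn: "\<And>x. 0 \<le> k x"
    and k0: "AE x in M. k x = 0 \<longrightarrow> u x = 0"
    using exists_test_function by blast
  have [measurable]: "k \<in> borel_measurable M" "a \<in> borel_measurable M"
    by (auto intro: measurable_from_subalg[OF subalg])
  have *: "AE x in M. b x * g x = 0" if b[measurable]: "b \<in> borel_measurable F"
    and "AE x in M. b x * (u x * w x) = 0" for b
  proof -
    have [measurable]: "b \<in> borel_measurable M" by (rule measurable_from_subalg[OF subalg b])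
    have "AE x in M. complex_cond_exp M F (\<lambda>y. b y * (u y * w y)) x = complex_cond_exp M F (\<lambda>y. 0) x"
      by (rule complex_cond_exp_cong) (use that in auto)
    with complex_cond_exp_mult[OF b uw_domain] complex_cond_exp_zero show ?thesis
      by eventually_elim (simp add: g_def)
  qed
  have "AE x in M. (a x * complex_of_real (k x)) * g x = 0"
  proof (rule *)
    show "AE x in M. (a x * complex_of_real (k x)) * (u x * w x) = 0"
      using 0[OF f] Tf by eventually_elim auto
  qed measurable
  moreover have "AE x in M. indicator {0} (k x) * g x = 0"
  proof (rule *)
    show "AE x in M. indicator {0} (k x) * (u x * w x) = 0"
      using k0 by eventually_elim (auto simp: indicator_def)
  qed measurable
  ultimately show ?thesis
    by eventually_elim (auto simp: indicator_def split: if_splits)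
qed

section \<open>Invertibility of \<open>T - l\<close>\<close>

lemma Lp_zero: "(\<lambda>x. 0) \<in> Lp_space M p"
proof -
  obtain f k where "f \<in> Lp_space M p" by (rule exists_test_function)
  then show ?thesis using Lp_cmult(1)[of f M p 0] p by simp
qed

lemma invertible_if_g_eq_0:
  assumes g0: "AE x in M. g x = 0" and l: "l \<noteq> 0"
  shows "Lp_invertible M p (\<lambda>f x. T f x - l * f x)"
proof -
  \<comment> \<open>These are the first two coefficients of the Neumann series of the inverse of
    \<open>T - l\<close>, which stops there because the square of \<open>T\<close> is zero.\<close>
  define \<alpha> \<beta> where "\<alpha> = - (1 / l)" and "\<beta> = - (1 / l\<^sup>2)"
  define S where "S = (\<lambda>f x. \<alpha> * f x + \<beta> * T f x)"
  note Lp = Lp_cmult(1)[OF _ p] Lp_add_quasi_triangle(1)[OF _ _ p] T_Lp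
  have SLp: "S f \<in> Lp_space M p" if "f \<in> Lp_space M p" for f
    unfolding S_def using that by (intro Lp)
  have TT: "AE x in M. T (T f) x = 0" if "f \<in> Lp_space M p" for f
    using T_T[OF that] g0 by eventually_elim simp
  have TS: "AE x in M. T (\<lambda>y. c * f y + d * T f y) x = c * T f x" if f: "f \<in> Lp_space M p" for f c d
    using T_add[OF Lp(1)[OF f, of c] Lp(1)[OF T_Lp[OF f], of d]]
      T_cmult[OF f, of c] T_cmult[OF T_Lp[OF f], of d] TT[OF f]
    by eventually_elim simp
  have bS: "Lp_bounded_operator M p S"
    unfolding Lp_bounded_operator_def
  proof (intro conjI ballI allI impI)
    fix f h assume f: "f \<in> Lp_space M p" and h: "h \<in> Lp_space M p"
    show "AE x in M. S f x = S h x" if "AE x in M. f x = h x"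
      using T_cong[OF f h that] that by eventually_elim (simp add: S_def)
    show "AE x in M. S (\<lambda>y. f y + h y) x = S f x + S h x"
      using T_add[OF f h] by eventually_elim (simp add: S_def algebra_simps)
  next
    fix c f assume "f \<in> Lp_space M p"
    then show "AE x in M. S (\<lambda>y. c * f y) x = c * S f x"
      using T_cmult[of f c] by (auto simp: S_def algebra_simps)
  next
    obtain C where C: "0 \<le> C" "\<And>f. f \<in> Lp_space M p \<Longrightarrow> Lp_norm M p (T f) \<le> C * Lp_norm M p f"
      using T_bound by blast
    have "Lp_norm M p (S f) \<le> 4 * (norm \<alpha> + norm \<beta> * C) * Lp_norm M p f" if f: "f \<in> Lp_space M p" for f
    proof -
      have "Lp_norm M p (S f) \<le> 4 * (Lp_norm M p (\<lambda>x. \<alpha> * f x) + Lp_norm M p (\<lambda>x. \<beta> * T f x))"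
        unfolding S_def using f by (intro Lp_add_quasi_triangle(2) Lp p)
      also have "\<dots> \<le> 4 * (norm \<alpha> * Lp_norm M p f + norm \<beta> * Lp_norm M p (T f))"
        using f T_Lp[OF f] p by (intro mult_left_mono add_mono Lp_cmult(2)) auto
      also have "\<dots> \<le> 4 * (norm \<alpha> * Lp_norm M p f + norm \<beta> * (C * Lp_norm M p f))"
        using C(2)[OF f] by (intro mult_left_mono add_mono) auto
      finally show ?thesis by (simp add: algebra_simps)
    qed
    then show "\<exists>C. \<forall>f\<in>Lp_space M p. Lp_norm M p (S f) \<le> C * Lp_norm M p f" by blast
  qed (rule SLp)
  \<comment> \<open>In either order of composition the coefficient of \<open>f\<close> is
    \<open>- l * \<alpha>\<close> and that of \<open>T f\<close> is
    \<open>\<alpha> - l * \<beta>\<close>; they have to be 1 and 0.\<close>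
  have \<alpha>: "l * \<alpha> = - 1" and \<beta>: "l * \<beta> = \<alpha>"
    using l by (simp_all add: \<alpha>_def \<beta>_def power2_eq_square)
  have "AE x in M. S (\<lambda>x. T f x - l * f x) x = f x" if f: "f \<in> Lp_space M p" for f
  proof -
    have eq: "(\<lambda>x. T f x - l * f x) = (\<lambda>x. - l * f x + 1 * T f x)" by auto
    have "AE x in M. T (\<lambda>x. T f x - l * f x) x = - l * T f x"
      unfolding eq by (rule TS[OF f])
    then show ?thesis
    proof eventually_elim
      case (elim x)
      have "S (\<lambda>x. T f x - l * f x) x = \<alpha> * T f x - (l * \<alpha>) * f x - (l * \<beta>) * T f x"
        unfolding S_def elim by (simp add: algebra_simps)
      then show ?case by (simp add: \<alpha> \<beta>)
    qed
  qed
  moreover have "AE x in M. T (S f) x - l * S f x = f x" if f: "f \<in> Lp_space M p" for f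
    using TS[OF f, of \<alpha> \<beta>]
  proof eventually_elim
    case (elim x)
    have "T (S f) x - l * S f x = \<alpha> * T f x - (l * \<alpha>) * f x - (l * \<beta>) * T f x"
      unfolding S_def elim by (simp add: algebra_simps)
    then show ?case by (simp add: \<alpha> \<beta>)
  qed
  ultimately show ?thesis
    unfolding Lp_invertible_def using bS by blast
qed

text \<open>A left inverse cancels both factors of \<open>T (T f) = 0\<close>, so every
  \<open>f\<close> would vanish; a strictly positive \<open>f\<close> does not. On a null space this
  fails: every operator is invertible there, and the spectrum is empty.\<close>

lemma not_invertible_if_g_eq_0:
  assumes g0: "AE x in M. g x = 0" and M: "emeasure M (space M) \<noteq> 0"
  shows "\<not> Lp_invertible M p T"
proof
  assume "Lp_invertible M p T"
  then obtain S where S: "Lp_bounded_operator M p S"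
    "\<And>f. f \<in> Lp_space M p \<Longrightarrow> AE x in M. S (T f) x = f x"
    by (auto simp: Lp_invertible_def)
  have S0: "AE x in M. S h x = 0" if h: "h \<in> Lp_space M p" and "AE x in M. h x = 0" for h
  proof -
    have "AE x in M. S h x = S (\<lambda>x. 0) x"
      using S(1) that Lp_zero by (simp add: Lp_bounded_operator_def)
    \<comment> \<open>Homogeneity with the scalar 0 yields the value of \<open>S\<close> at the zero
      function.\<close>
    moreover have "AE x in M. S (\<lambda>y. 0 * h y) x = 0 * S h x"
      using S(1) h unfolding Lp_bounded_operator_def by blast
    ultimately show ?thesis
      unfolding mult_zero_left by eventually_elim simp
  qed
  interpret sigma_finite_measure M
    using sigma_finite_subalgebra_is_sigma_finite sigma_finite_subalgebra_axioms by blast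
  obtain f0 :: "'a \<Rightarrow> real" where "f0 \<in> borel_measurable M" "\<And>x. 0 \<le> f0 x"
    and pos: "\<And>x. x \<in> space M \<Longrightarrow> 0 < f0 x"
    and Lp: "(\<lambda>x. complex_of_real (f0 x)) \<in> Lp_space M p"
    using exists_positive_Lp[OF p] by blast
  let ?f = "\<lambda>x. complex_of_real (f0 x)"
  have "AE x in M. T (T ?f) x = 0"
    using T_T[OF Lp] g0 by eventually_elim simp
  then have "AE x in M. S (T (T ?f)) x = 0"
    by (intro S0 T_Lp Lp)
  with S(2)[OF T_Lp[OF Lp]] have "AE x in M. T ?f x = 0" by eventually_elim simp
  then have "AE x in M. S (T ?f) x = 0"
    by (intro S0 T_Lp Lp)
  with S(2)[OF Lp] AE_space have "AE x in M. False"
  proof eventually_elim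
    case (elim x)
    then show ?case using pos[of x] by simp
  qed
  then show False using M by (simp add: ae_filter_eq_bot_iff[symmetric] trivial_limit_def)
qed

lemma g_eq_0_if_quasinilpotent:
  assumes qn: "\<And>l. l \<noteq> 0 \<Longrightarrow> Lp_invertible M p (\<lambda>f x. T f x - l * f x)"
  shows "AE x in M. g x = 0"
proof (rule ccontr)
  assume "\<not> ?thesis"
  then obtain l where l: "l \<noteq> 0" and ess: "\<And>e. e > 0 \<Longrightarrow> \<not> (AE x in M. g x \<notin> ball l e)"
    using exists_essential_value[of g M] by blast
  obtain S where S: "Lp_bounded_operator M p S"
    "\<And>f. f \<in> Lp_space M p \<Longrightarrow> AE x in M. S (\<lambda>x. T f x - l * f x) x = f x"
    using qn[OF l] by (auto simp: Lp_invertible_def)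
  obtain C where C: "\<And>f. f \<in> Lp_space M p \<Longrightarrow> Lp_norm M p (S f) \<le> C * Lp_norm M p f"
    using S(1) unfolding Lp_bounded_operator_def by blast
  \<comment> \<open>The bound by \<open>norm l\<close> keeps 0 out of \<open>ball l e\<close>; the
    other makes \<open>\<bar>C\<bar> * e\<close> less than 1. The absolute value is there since
    \<open>C\<close> may be negative, the added 1 since it may be 0.\<close>
  define e where "e = min (norm l) (1 / (2 * (\<bar>C\<bar> + 1)))"
  have e: "0 < e" "e \<le> norm l" "\<bar>C\<bar> * e < 1"
  proof -
    show "0 < e" "e \<le> norm l" using l by (auto simp: e_def)
    have "\<bar>C\<bar> * e \<le> \<bar>C\<bar> * (1 / (2 * (\<bar>C\<bar> + 1)))"
      by (intro mult_left_mono) (auto simp: e_def)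
    also have "\<dots> < 1" by (simp add: field_simps)
    finally show "\<bar>C\<bar> * e < 1" .
  qed
  define a where "a = (\<lambda>x. indicator (ball l e) (g x) :: complex)"
  have a[measurable]: "a \<in> borel_measurable F" 
    unfolding a_def by (rule measurable_compose[OF g_measurable(1) borel_measurable_indicator]) simp
  have [measurable]: "a \<in> borel_measurable M" by (rule measurable_from_subalg[OF subalg a])
  have "AE x in M. a x * T f x = 0" if f: "f \<in> Lp_space M p" for f
  proof -
    have [measurable]: "T f \<in> borel_measurable M" using T_Lp[OF f] by (rule Lp_space_measurable)
    define h where "h = (\<lambda>x. a x * T f x)"
    have [measurable]: "h \<in> borel_measurable M" unfolding h_def by measurable
    have h: "h \<in> Lp_space M p"
      by (rule Lp_dominated(1)[OF T_Lp[OF f], of _ 1])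
        (use p in \<open>auto simp: h_def a_def indicator_def\<close>)
    define r where "r = (\<lambda>x. T h x - l * h x)"
    have [measurable]: "T h \<in> borel_measurable M" using T_Lp[OF h] by (rule Lp_space_measurable)
    \<comment> \<open>By \<open>T_mult_T\<close>, \<open>r = (g - l) h\<close>, and \<open>h\<close>
      lives only where \<open>g\<close> is within \<open>e\<close> of \<open>l\<close>.\<close>
    have "AE x in M. norm (r x) \<le> e * norm (h x)"
      using T_mult_T[OF f a, folded h_def]
    proof eventually_elim
      case (elim x)
      then have "r x = (g x - l) * h x" by (simp add: r_def h_def algebra_simps)
      then show ?case
        by (cases "g x \<in> ball l e")
          (auto simp: h_def a_def norm_mult dist_norm norm_minus_commute intro!: mult_right_mono)
    qed
    then have r: "r \<in> Lp_space M p" "Lp_norm M p r \<le> e * Lp_norm M p h"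
      using Lp_dominated[OF h, of r e] e p by (auto simp: r_def)
    have Sr: "AE x in M. S r x = h x" using S(2)[OF h] by (simp add: r_def)
    \<comment> \<open>As \<open>h = S r\<close>, this chain bounds the norm of \<open>h\<close> by
      \<open>\<bar>C\<bar> * e < 1\<close> times itself, which forces it to be 0.\<close>
    have "Lp_norm M p h \<le> 1 * Lp_norm M p (S r)"
      using S(1) r(1) Sr p by (intro Lp_dominated(2)) (auto simp: Lp_bounded_operator_def)
    also have "\<dots> \<le> C * Lp_norm M p r" using C[OF r(1)] by simp
    also have "\<dots> \<le> \<bar>C\<bar> * Lp_norm M p r" by (intro mult_right_mono Lp_norm_nonneg) auto
    also have "\<dots> \<le> \<bar>C\<bar> * (e * Lp_norm M p h)" using r(2) by (intro mult_left_mono) auto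
    finally have "(1 - \<bar>C\<bar> * e) * Lp_norm M p h \<le> 0" by (simp add: algebra_simps)
    then have "Lp_norm M p h = 0"
      using e(3) Lp_norm_nonneg[of M p h] by (auto simp: mult_le_0_iff)
    then show ?thesis using Lp_norm_eq_0_imp_AE[OF h p] by (simp add: h_def)
  qed
  then have "AE x in M. a x * g x = 0" by (intro mult_g_eq_0I) auto
  then have "AE x in M. g x \<notin> ball l e"
    by eventually_elim (use e in \<open>auto simp: a_def dist_norm\<close>)
  with ess[OF e(1)] show False ..
qed

end

section \<open>Equivalence of the three conditions\<close>

theorem corollary3p6:
  fixes M F :: "'a measure" and p :: ennreal and u w :: "'a \<Rightarrow> complex"
  assumes "complete_measure M"
    and "sigma_finite_measure M"
    and "sigma_finite_subalgebra M F"
    and "emeasure M (space M) \<noteq> 0"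
    and "u \<in> cond_exp_domain M F"
    and "w \<in> cond_exp_domain M F"
    and "1 \<le> p"
    and "\<And>f. f \<in> Lp_space M p \<Longrightarrow> (\<lambda>x. u x * f x) \<in> cond_exp_domain M F"
    and "Lp_bounded_operator M p (weighted_cond_op M F w u)"
  shows "(Lp_quasinilpotent M p (weighted_cond_op M F w u)
            \<longleftrightarrow> (AE x in M. complex_cond_exp M F (\<lambda>y. u y * w y) x = 0))
       \<and> ((AE x in M. complex_cond_exp M F (\<lambda>y. u y * w y) x = 0)
            \<longleftrightarrow> (\<forall>f\<in>Lp_space M p. AE x in M.
                  weighted_cond_op M F (\<lambda>y. w y * complex_cond_exp M F (\<lambda>z. u z * w z) y) u f x = 0))"
proof -
  interpret sigma_finite_subalgebra M F by fact
  interpret bounded_weighted_cond_op M F p u w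
    by unfold_locales fact+
  have "Lp_quasinilpotent M p T \<longleftrightarrow> (AE x in M. g x = 0)"
  proof
    assume "Lp_quasinilpotent M p T"
    then show "AE x in M. g x = 0"
      by (intro g_eq_0_if_quasinilpotent) (auto simp: Lp_quasinilpotent_def Lp_spectrum_def)
  next
    assume "AE x in M. g x = 0"
    then have "Lp_invertible M p (\<lambda>f x. T f x - l * f x) \<longleftrightarrow> l \<noteq> 0" for l
      using invertible_if_g_eq_0[of l] not_invertible_if_g_eq_0 assms(4) by auto
    then show "Lp_quasinilpotent M p T"
      by (auto simp: Lp_quasinilpotent_def Lp_spectrum_def)
  qed
  moreover have "(AE x in M. g x = 0)
      \<longleftrightarrow> (\<forall>f\<in>Lp_space M p. AE x in M. weighted_cond_op M F (\<lambda>y. w y * g y) u f x = 0)"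
  proof
    assume "AE x in M. g x = 0"
    then show "\<forall>f\<in>Lp_space M p. AE x in M. weighted_cond_op M F (\<lambda>y. w y * g y) u f x = 0"
      by (auto simp: weighted_cond_op_def)
  next
    assume *: "\<forall>f\<in>Lp_space M p. AE x in M. weighted_cond_op M F (\<lambda>y. w y * g y) u f x = 0"
    \<comment> \<open>The operator with weight \<open>w g\<close> is
      \<open>f \<mapsto> g T f\<close>, so \<open>mult_g_eq_0I\<close> applies with
      \<open>a = g\<close>.\<close>
    have "AE x in M. g x * g x = 0"
    proof (rule mult_g_eq_0I)
      fix f assume "f \<in> Lp_space M p"
      with * show "AE x in M. g x * T f x = 0"
        by (auto simp: weighted_cond_op_def)
    qed measurable
    then show "AE x in M. g x = 0" by simp
  qed
  ultimately show ?thesis by (simp add: g_def)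
qed

end
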